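(* Let $n\ge1$, let $R>0$, let $X\subset B(0,R)\subset\mathbb{R}^n$ be a compact set and let $f:X\to X$ be a homeomorphism. Then there exists a homeomorphism $\hat f:\mathbb{R}^{2n}\to\mathbb{R}^{2n}$ (with $\mathbb{R}^{2n}=\mathbb{R}^n\times\mathbb{R}^n$) such that $$\hat f(x,0_n)=(f(x),0_n)\quad\text{for all } x\in X,$$ where $0_n$ is the origin in $\mathbb{R}^n$, and such that for any $r\ge R$ $$(x,y)\in B(0,r)\times B(0,r)\ \Rightarrow\ \hat f(x,y)\in B(0,r)\times B(0,r).$$
   Context: $B(0,r)$ denotes the open Euclidean ball in $\mathbb{R}^n$ of radius $r$ centred at the origin. *)

theory Defs
  imports "HOL-Analysis.Analysis"
begin

end

theory Submission imports Defs begin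

text \<open>
  Extend \<open>f\<close> and its inverse to maps of the whole space into a closed ball of radius \<open>\<rho> < R\<close>
  containing \<open>X\<close>.  The push \<open>\<phi>\<^sub>p y = y + max 0 (1 - |y|/R) p\<close>, for \<open>|p| \<le> \<rho>\<close>, is the identity off the
  ball of radius \<open>R\<close>, maps \<open>0\<close> to \<open>p\<close>, and is a homeomorphism because it perturbs the identity by
  a \<open>\<rho>/R\<close>-Lipschitz map.  The wanted map is
  \<open>(x, y) \<mapsto> (v, \<phi>\<^sub>q\<^sup>-\<^sup>1 x)\<close> with \<open>v = \<phi>\<^sub>p y\<close>, \<open>p = f x\<close>, \<open>q = f\<^sup>-\<^sup>1 v\<close>: the point \<open>(x, 0)\<close> goes to
  \<open>(f x, \<phi>\<^sub>x\<^sup>-\<^sup>1 x) = (f x, 0)\<close>.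
\<close>

definition push :: "real \<Rightarrow> 'a::real_normed_vector \<Rightarrow> 'a \<Rightarrow> 'a" where
  "push R p y = y + max 0 (1 - norm y / R) *\<^sub>R p"

lemma push_0 [simp]: "push R p 0 = p"
  by (simp add: push_def)

lemma push_outside:
  assumes "R > 0" "norm y \<ge> R"
  shows "push R p y = y"
  using assms by (simp add: push_def max_def field_simps)

text \<open>The bump equals \<open>(R - norm y) / R\<close>, so \<open>y\<close> moves by less than
  its distance \<open>R - norm y\<close> to the sphere.\<close>

lemma norm_push_less:
  assumes "R > 0" "norm p < R" "norm y < R"
  shows "norm (push R p y) < R"
proof -
  have pos: "1 - norm y / R > 0"
    using assms by (simp add: field_simps)
  then have "norm (push R p y) \<le> norm y + (1 - norm y / R) * norm p"
    using norm_triangle_ineq[of y "(1 - norm y / R) *\<^sub>R p"] by (simp add: push_def)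
  also have "\<dots> < norm y + (1 - norm y / R) * R"
    using pos assms by (intro add_strict_left_mono mult_strict_left_mono)
  also have "\<dots> = R"
    using assms by (simp add: field_simps)
  finally show ?thesis .
qed

text \<open>Points of norm below \<open>R\<close> stay there and all others are fixed, which settles
  every \<open>r \<ge> R\<close> at once.\<close>

lemma push_ball_iff:
  assumes "R > 0" "norm p < R" "R \<le> r"
  shows "push R p y \<in> ball 0 r \<longleftrightarrow> y \<in> ball 0 r"
  using assms push_outside[of R y p] norm_push_less[of R p y]
  by (cases "norm y < R") auto

lemma bump_lipschitz:
  fixes y z :: "'a::real_normed_vector"
  assumes "R > 0"
  shows "\<bar>max 0 (1 - norm y / R) - max 0 (1 - norm z / R)\<bar> \<le> norm (y - z) / R"
proof -
  have "\<bar>max 0 (1 - norm y / R) - max 0 (1 - norm z / R)\<bar> \<le> \<bar>norm y / R - norm z / R\<bar>"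
    by (auto simp: max_def abs_if)
  also have "\<dots> = \<bar>norm y - norm z\<bar> / R"
    using assms by (simp add: diff_divide_distrib [symmetric])
  also have "\<dots> \<le> norm (y - z) / R"
    using assms by (intro divide_right_mono norm_triangle_ineq3) auto
  finally show ?thesis .
qed

lemma bij_push:
  fixes p :: "'a::banach"
  assumes R: "R > 0" and p: "norm p < R"
  shows "bij (push R p)"
proof -
  have c: "0 \<le> norm p / R" "norm p / R < 1"
    using R p by auto
  have "\<exists>!y. push R p y = z" for z
  proof -
    \<comment> \<open>Solutions of \<open>push R p y = z\<close> are the fixed points of
      \<open>?g\<close>, a contraction with constant \<open>norm p / R\<close>.\<close>
    let ?g = "\<lambda>y. z - max 0 (1 - norm y / R) *\<^sub>R p"
    have "dist (?g y) (?g y') \<le> norm p / R * dist y y'" for y y'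
    proof -
      have "dist (?g y) (?g y') =
          \<bar>max 0 (1 - norm y' / R) - max 0 (1 - norm y / R)\<bar> * norm p"
        by (simp add: dist_norm flip: scaleR_diff_left)
      also have "\<dots> \<le> norm (y' - y) / R * norm p"
        by (intro mult_right_mono bump_lipschitz R) auto
      finally show ?thesis
        by (simp add: dist_norm norm_minus_commute mult.commute)
    qed
    then have "\<exists>!y. ?g y = y"
      using banach_fix_type[OF c, of ?g] by blast
    moreover have "push R p y = z \<longleftrightarrow> ?g y = y" for y
      unfolding push_def by (metis add_diff_cancel_right' diff_add_cancel)
    ultimately show ?thesis
      by simp
  qed
  then show ?thesis
    by (metis bijI')
qed

text \<open>Each fibre map is bijective; invariance of domain then makes the inverse jointly
  continuous, with no estimate of how the fixed point depends on \<open>x\<close>.\<close>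

lemma homeomorphism_fibrewise_push:
  fixes a :: "'a::euclidean_space \<Rightarrow> 'a"
  assumes R: "R > 0" and a: "\<And>x. norm (a x) < R" "continuous_on UNIV a"
  obtains T where "homeomorphism UNIV UNIV (\<lambda>(x, y). (x, push R (a x) y)) T"
proof -
  let ?S = "\<lambda>(x, y). (x, push R (a x) y)"
  have bij: "bij (push R (a x))" for x
    using R a by (intro bij_push)
  have cont: "continuous_on UNIV ?S"
    unfolding push_def case_prod_beta
    using R by (intro continuous_intros continuous_on_compose2[OF a(2)]) auto
  have inj: "inj ?S"
    using bij by (auto simp: inj_on_def bij_def)
  have "surj ?S"
    unfolding surj_def using bij_is_surj[OF bij] by (auto simp: surj_def)
  then show ?thesis
    using invariance_of_domain_homeomorphism[OF open_UNIV cont _ inj] that by auto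
qed

text \<open>Tietze extension keeps only a non-strict bound \<open>\<rho>\<close>, whereas push
  parameters must have norm strictly below \<open>R\<close>; compactness supplies the gap.\<close>

lemma compact_subset_ball_imp_cball:
  fixes X :: "'a::real_normed_vector set"
  assumes "R > 0" "compact X" "X \<subseteq> ball 0 R"
  obtains \<rho> where "0 \<le> \<rho>" "\<rho> < R" "X \<subseteq> cball 0 \<rho>"
proof (cases "X = {}")
  case True
  with assms that[of 0] show ?thesis by simp
next
  case False
  have "continuous_on X norm"
    by (intro continuous_intros)
  with assms False obtain x where "x \<in> X" "\<forall>y\<in>X. norm y \<le> norm x"
    using continuous_attains_sup by blast
  with assms that[of "norm x"] show ?thesis by (auto simp: subset_iff)
qed

theorem proposition5p3:
  fixes X :: "(real ^ 'n) set" and f :: "real ^ 'n \<Rightarrow> real ^ 'n" and R :: real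
  assumes "R > 0"
    and "compact X"
    and "X \<subseteq> ball 0 R"
    and "\<exists>g. homeomorphism X X f g"
  shows "\<exists>F :: (real ^ 'n) \<times> (real ^ 'n) \<Rightarrow> (real ^ 'n) \<times> (real ^ 'n).
           (\<exists>G. homeomorphism UNIV UNIV F G) \<and>
           (\<forall>x\<in>X. F (x, 0) = (f x, 0)) \<and>
           (\<forall>r\<ge>R. \<forall>x y. (x, y) \<in> ball 0 r \<times> ball 0 r \<longrightarrow> F (x, y) \<in> ball 0 r \<times> ball 0 r)"
proof -
  obtain g where g: "homeomorphism X X f g"
    using assms(4) by blast
  obtain \<rho> where \<rho>: "0 \<le> \<rho>" "\<rho> < R" "X \<subseteq> cball 0 \<rho>"
    using compact_subset_ball_imp_cball assms(1-3) by blast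
  \<comment> \<open>Off \<open>X\<close> the extensions of \<open>f\<close> and \<open>g\<close>
    need not be mutually inverse: bijectivity of the final map comes from the pushes.\<close>
  have extend: "\<exists>h'. continuous_on UNIV h' \<and> (\<forall>x. norm (h' x) < R) \<and> (\<forall>x\<in>X. h' x = h x)"
    if "continuous_on X h" "h ` X \<subseteq> X" for h :: "real ^ 'n \<Rightarrow> real ^ 'n"
  proof -
    have closed: "closedin (top_of_set UNIV) X"
      using assms(2) by (simp add: compact_imp_closed)
    have bound: "norm (h x) \<le> \<rho>" if "x \<in> X" for x
      using \<open>h ` X \<subseteq> X\<close> \<rho>(3) that by (meson image_subset_iff mem_cball_0 subsetD)
    obtain h' where "continuous_on UNIV h'" "\<And>x. x \<in> X \<Longrightarrow> h' x = h x"
      "\<And>x. norm (h' x) \<le> \<rho>"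
      using Tietze[OF \<open>continuous_on X h\<close> closed \<rho>(1) bound] by (metis UNIV_I)
    moreover from this \<rho> have "norm (h' x) < R" for x
      by (meson le_less_trans)
    ultimately show ?thesis
      by blast
  qed
  obtain a where a: "continuous_on UNIV a" "\<And>x. norm (a x) < R" "\<And>x. x \<in> X \<Longrightarrow> a x = f x"
    using extend[of f] homeomorphism_cont1[OF g] homeomorphism_image1[OF g] by blast
  obtain b where b: "continuous_on UNIV b" "\<And>x. norm (b x) < R" "\<And>x. x \<in> X \<Longrightarrow> b x = g x"
    using extend[of g] homeomorphism_cont2[OF g] homeomorphism_image2[OF g] by blast
  let ?S = "\<lambda>(x, y). (x, push R (a x) y)"
  let ?S' = "\<lambda>(x, y). (x, push R (b x) y)"
  obtain A where A: "homeomorphism UNIV UNIV ?S A"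
    by (rule homeomorphism_fibrewise_push[OF assms(1) a(2,1)])
  obtain B where B: "homeomorphism UNIV UNIV ?S' B"
    by (rule homeomorphism_fibrewise_push[OF assms(1) b(2,1)])
  have swap: "homeomorphism UNIV UNIV prod.swap (prod.swap :: (real ^ 'n) \<times> (real ^ 'n) \<Rightarrow> _)"
    by (intro homeomorphismI) (auto simp: prod.swap_def intro!: continuous_intros)
  have B_eq: "B (?S' z) = z" and S'_B: "?S' (B z) = z" for z
    using homeomorphism_apply1[OF B] homeomorphism_apply2[OF B] by blast+
  \<comment> \<open>After the swap the point is \<open>(v, x)\<close> with
    \<open>v = push R (a x) y\<close>; \<open>B\<close> solves \<open>push R (b v) w = x\<close> for
    \<open>w\<close>.\<close>
  let ?F = "B \<circ> (prod.swap \<circ> ?S)"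
  have "\<exists>G. homeomorphism UNIV UNIV ?F G"
    using homeomorphism_compose[OF homeomorphism_compose[OF A swap] homeomorphism_symD[OF B]] by blast
  moreover have "?F (x, 0) = (f x, 0)" if "x \<in> X" for x
  proof -
    have "f x \<in> X" "g (f x) = x"
      using g that by (auto simp: homeomorphism_def)
    \<comment> \<open>Here \<open>b (f x) = g (f x) = x\<close>, and a push sends \<open>0\<close>
      to its parameter. The value is also the swap of \<open>?S (x, 0)\<close>, so \<open>B\<close>
      takes it back to \<open>(f x, 0)\<close>.\<close>
    then have "?S' (f x, 0) = (f x, x)"
      using b by simp
    then show ?thesis
      using B_eq[of "(f x, 0)"] a that by simp
  qed
  moreover have "?F (x, y) \<in> ball 0 r \<times> ball 0 r"
    if "r \<ge> R" "(x, y) \<in> ball 0 r \<times> ball 0 r" for r x y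
  proof -
    obtain v w where vw: "?F (x, y) = (v, w)"
      by fastforce
    then have "B (push R (a x) y, x) = (v, w)"
      by simp
    with S'_B[of "(push R (a x) y, x)"] have "?S' (v, w) = (push R (a x) y, x)"
      by (simp only:)
    then have "v = push R (a x) y" "push R (b v) w = x"
      by auto
    \<comment> \<open>The equivalence serves in both directions: from \<open>y\<close> to its image
      \<open>v\<close>, and from the image \<open>x\<close> back to \<open>w\<close>.\<close>
    then have "v \<in> ball 0 r" "w \<in> ball 0 r"
      using that push_ball_iff[OF assms(1) a(2) that(1), of x y]
        push_ball_iff[OF assms(1) b(2) that(1), of v w] by simp_all
    then show ?thesis
      using vw by simp
  qed
  ultimately show ?thesis
    by - (rule exI[of _ ?F], intro conjI ballI allI impI)
qed

end
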